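(* Let $\boldsymbol{P}\in\mathbb{R}^{[3,n]}$ be a stochastic tensor and let $s=\mathcal{T}_L(\boldsymbol{P})+\mathcal{T}_R(\boldsymbol{P})$. If $s<1$ then, for all $x_0,x_{-1}\in\mathcal{S}_1$, the iteration $$x_{t+1}=\boldsymbol{P}x_tx_{t-1},\qquad t=0,1,2,\dots$$ converges to the unique $x\in\mathcal{S}_1$ such that $x=\boldsymbol{P}xx$. In fact, for all $x_0,x_{-1}\in\mathcal{S}_1$ and $t=0,1,\ldots$ it holds $$\|x_{t+1}-x\|_1\le s^{\lceil(t+1)/2\rceil}\max\{\|x_0-x\|_1,\|x_{-1}-x\|_1\}.$$
   Context: $\mathbb{R}^{[3,n]}$ is the set of real $n\times n\times n$ arrays $\boldsymbol{P}=(\boldsymbol{P}_{ijk})$, $n\ge 2$. $\boldsymbol{P}$ is called stochastic if $\boldsymbol{P}_{ijk}\ge 0$ for all $i,j,k$ and $\sum_{i=1}^n\boldsymbol{P}_{ijk}=1$ for all $j,k$. For $x,y\in\mathbb{R}^n$, $(\boldsymbol{P}xy)_i=\sum_{j,k}\boldsymbol{P}_{ijk}x_jy_k$. Let $\mathcal{S}_1=\{x\in\mathbb{R}^n: x\ge 0,\ \|x\|_1=1\}$ and $\mathcal{Z}_1=\{x\in\mathbb{R}^n:\sum_i x_i=0,\ \|x\|_1=1\}$. Definitions: $\mathcal{T}_L(\boldsymbol{P})=\max_{x\in\mathcal{S}_1}\max_{y\in\mathcal{Z}_1}\|\boldsymbol{P}xy\|_1$ and $\mathcal{T}_R(\boldsymbol{P})=\max_{x\in\mathcal{S}_1}\max_{y\in\mathcal{Z}_1}\|\boldsymbol{P}yx\|_1$.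 *)

theory Defs
  imports "HOL-Analysis.Analysis"
begin

text \<open>The index set \<open>{1..n}\<close> is the finite type \<open>'n\<close>, and the entry \<open>P\<^sub>i\<^sub>j\<^sub>k\<close> of a tensor is \<open>P $ i $ j $ k\<close>.\<close>

type_synonym 'n tensor3 = "real ^ 'n ^ 'n ^ 'n"

definition stochastic :: "'n::finite tensor3 \<Rightarrow> bool" where
  "stochastic P \<longleftrightarrow>
     (\<forall>i j k. 0 \<le> P $ i $ j $ k) \<and> (\<forall>j k. (\<Sum>i\<in>UNIV. P $ i $ j $ k) = 1)"

definition tensor_apply :: "'n::finite tensor3 \<Rightarrow> real ^ 'n \<Rightarrow> real ^ 'n \<Rightarrow> real ^ 'n" where
  "tensor_apply P x y = (\<chi> i. \<Sum>j\<in>UNIV. \<Sum>k\<in>UNIV. P $ i $ j $ k * x $ j * y $ k)"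

text \<open>The library's \<open>norm\<close> on \<open>real ^ 'n\<close> is the Euclidean norm.\<close>

definition norm1 :: "real ^ 'n::finite \<Rightarrow> real" where
  "norm1 x = (\<Sum>i\<in>UNIV. \<bar>x $ i\<bar>)"

definition S1 :: "(real ^ 'n::finite) set" where
  "S1 = {x. (\<forall>i. 0 \<le> x $ i) \<and> norm1 x = 1}"

definition Z1 :: "(real ^ 'n::finite) set" where
  "Z1 = {x. (\<Sum>i\<in>UNIV. x $ i) = 0 \<and> norm1 x = 1}"

text \<open>The maxima below are written as suprema. They are attained, since \<open>S1\<close> and \<open>Z1\<close> are
  compact and the objective is continuous, provided \<open>Z1\<close> is nonempty, that is, \<open>CARD('n) \<ge> 2\<close>.\<close>

definition T_L :: "'n::finite tensor3 \<Rightarrow> real" where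
  "T_L P = (SUP x\<in>S1. SUP y\<in>Z1. norm1 (tensor_apply P x y))"

definition T_R :: "'n::finite tensor3 \<Rightarrow> real" where
  "T_R P = (SUP x\<in>S1. SUP y\<in>Z1. norm1 (tensor_apply P y x))"

text \<open>Sequences are indexed by integers so that the initial values can be \<open>x 0\<close> and \<open>x (-1)\<close>;
  entries of index below \<open>-1\<close> are unconstrained.\<close>

definition is_iteration :: "'n::finite tensor3 \<Rightarrow> (int \<Rightarrow> real ^ 'n) \<Rightarrow> bool" where
  "is_iteration P x \<longleftrightarrow> (\<forall>t\<ge>0. x (t + 1) = tensor_apply P (x t) (x (t - 1)))"

end

theory Submission
  imports Defs
begin

text \<open>For \<open>u, v, u', v' \<in> S1\<close>, bilinearity gives \<open>P u v - P u' v' = P u (v - v') + P (u - u') v'\<close>, and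
  differences of points of \<open>S1\<close> sum to zero, so the 1-norm of this is at most
  \<open>T_L P * norm1 (v - v') + T_R P * norm1 (u - u')\<close>. Taking \<open>u = v\<close> and \<open>u' = v'\<close> shows that
  \<open>x \<mapsto> P x x\<close> is an \<open>s\<close>-contraction of \<open>S1\<close>, whence uniqueness of the fixed point; existence is
  Brouwer's theorem. Taking \<open>u' = v' = x\<close> the fixed point, the error of the iteration satisfies
  \<open>e (t + 1) \<le> s * max (e t) (e (t - 1))\<close>, and so gains a factor \<open>s\<close> every two steps.\<close>

section \<open>The 1-norm, the simplex \<open>S1\<close> and the zero-sum sphere
  \<open>Z1\<close>\<close>

lemma norm1_nonneg: "0 \<le> norm1 x"
  by (simp add: norm1_def sum_nonneg)

lemma norm1_zero [simp]: "norm1 0 = 0"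
  by (simp add: norm1_def)

lemma norm1_eq_0_iff: "norm1 x = 0 \<longleftrightarrow> x = 0"
  by (simp add: norm1_def sum_nonneg_eq_0_iff vec_eq_iff)

lemma norm1_scaleR: "norm1 (c *\<^sub>R x) = \<bar>c\<bar> * norm1 x"
  by (simp add: norm1_def abs_mult sum_distrib_left)

lemma norm1_triangle: "norm1 (x + y) \<le> norm1 x + norm1 y"
  by (simp add: norm1_def sum.distrib [symmetric] sum_mono)

lemma norm_le_norm1: "norm x \<le> norm1 x"
  unfolding norm1_def by (rule norm_le_l1_cart)

text \<open>On nonnegative vectors the 1-norm is the plain sum, so membership becomes a set of
  linear constraints, from which closedness and convexity can be read off.\<close>

lemma S1_iff: "x \<in> S1 \<longleftrightarrow> (\<forall>i. 0 \<le> x $ i) \<and> (\<Sum>i\<in>UNIV. x $ i) = 1"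
  by (auto simp: S1_def norm1_def)

lemma sum_diff_S1: "x \<in> S1 \<Longrightarrow> y \<in> S1 \<Longrightarrow> (\<Sum>i\<in>UNIV. (x - y) $ i) = 0"
  by (simp add: S1_iff sum_subtractf)

lemma axis_in_S1: "axis i 1 \<in> (S1 :: (real ^ 'n::finite) set)"
  by (auto simp: S1_iff axis_def)

text \<open>In dimension one only 0 has coordinate sum 0; with two indices, the normalised
  difference of two basis vectors works. A point of \<open>Z1\<close> is what forces
  \<open>T_L\<close> and \<open>T_R\<close> to be nonnegative.\<close>

lemma Z1_nonempty:
  assumes "CARD('n::finite) \<ge> 2"
  shows "(Z1 :: (real ^ 'n) set) \<noteq> {}"
proof -
  obtain i j :: 'n where "i \<noteq> j"
    using assms card_le_Suc0_iff_eq [OF finite, of "UNIV :: 'n set"] by auto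
  define z :: "real ^ 'n" where "z = axis i 1 - axis j 1"
  have "z \<noteq> 0"
    using \<open>i \<noteq> j\<close> by (simp add: z_def axis_eq_axis)
  moreover have "(\<Sum>k\<in>UNIV. z $ k) = 0"
    unfolding z_def by (rule sum_diff_S1 [OF axis_in_S1 axis_in_S1])
  ultimately have "(1 / norm1 z) *\<^sub>R z \<in> Z1"
    by (simp add: Z1_def norm1_scaleR norm1_nonneg norm1_eq_0_iff sum_distrib_left [symmetric] sum_divide_distrib [symmetric])
  then show ?thesis by blast
qed

lemma compact_S1: "compact (S1 :: (real ^ 'n::finite) set)"
proof -
  have "norm x \<le> 1" if "x \<in> S1" for x :: "real ^ 'n"
    using norm_le_norm1 [of x] that by (simp add: S1_def)
  then have "bounded (S1 :: (real ^ 'n) set)"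
    by (auto simp: bounded_iff)
  moreover have "closed (S1 :: (real ^ 'n) set)"
  proof -
    have "S1 = (\<Inter>i. {x :: real ^ 'n. 0 \<le> x $ i}) \<inter> {x. (\<Sum>i\<in>UNIV. x $ i) = 1}"
      by (auto simp: S1_iff)
    moreover have "closed \<dots>"
      by (intro closed_Int closed_INT ballI closed_Collect_le closed_Collect_eq continuous_intros)
    ultimately show ?thesis by simp
  qed
  ultimately show ?thesis by (simp add: compact_eq_bounded_closed)
qed

lemma convex_S1: "convex (S1 :: (real ^ 'n::finite) set)"
  by (auto simp: convex_def S1_iff sum.distrib sum_distrib_left [symmetric])

section \<open>The bilinear map of a stochastic tensor\<close>

lemma tensor_apply_scaleR_right: "tensor_apply P x (c *\<^sub>R y) = c *\<^sub>R tensor_apply P x y"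
  by (simp add: tensor_apply_def vec_eq_iff sum_distrib_left mult_ac)

lemma tensor_apply_diff:
  "tensor_apply P u v - tensor_apply P u' v' = tensor_apply P u (v - v') + tensor_apply P (u - u') v'"
  by (simp add: tensor_apply_def vec_eq_iff sum_subtractf [symmetric] sum.distrib [symmetric] algebra_simps)

text \<open>Moving the sum over \<open>i\<close> innermost exposes the sums that stochasticity sets
  to 1. With absolute values in \<open>f\<close> this bounds the 1-norm; without them it shows that
  \<open>S1\<close> is preserved.\<close>

lemma sum_stochastic:
  fixes P :: "'n::finite tensor3"
  assumes "stochastic P"
  shows "(\<Sum>i\<in>UNIV. \<Sum>j\<in>UNIV. \<Sum>k\<in>UNIV. P $ i $ j $ k * f j k) = (\<Sum>j\<in>UNIV. \<Sum>k\<in>UNIV. f j k)"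
proof -
  have "(\<Sum>i\<in>UNIV. \<Sum>j\<in>UNIV. \<Sum>k\<in>UNIV. P $ i $ j $ k * f j k)
      = (\<Sum>j\<in>UNIV. \<Sum>i\<in>UNIV. \<Sum>k\<in>UNIV. P $ i $ j $ k * f j k)"
    by (rule sum.swap)
  also have "\<dots> = (\<Sum>j\<in>UNIV. \<Sum>k\<in>UNIV. \<Sum>i\<in>UNIV. P $ i $ j $ k * f j k)"
    by (intro sum.cong refl sum.swap)
  also have "\<dots> = (\<Sum>j\<in>UNIV. \<Sum>k\<in>UNIV. f j k)"
    using assms by (simp add: stochastic_def sum_distrib_right [symmetric])
  finally show ?thesis .
qed

lemma norm1_tensor_apply_le:
  assumes "stochastic P"
  shows "norm1 (tensor_apply P x y) \<le> norm1 x * norm1 y"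
proof -
  have "norm1 (tensor_apply P x y)
      \<le> (\<Sum>i\<in>UNIV. \<Sum>j\<in>UNIV. \<Sum>k\<in>UNIV. P $ i $ j $ k * (\<bar>x $ j\<bar> * \<bar>y $ k\<bar>))"
    unfolding norm1_def tensor_apply_def
    using assms
    by (auto intro!: sum_mono order_trans [OF sum_abs] simp: stochastic_def abs_mult)
  also have "\<dots> = norm1 x * norm1 y"
    by (simp add: sum_stochastic [OF assms] norm1_def sum_product)
  finally show ?thesis .
qed

lemma tensor_apply_in_S1:
  assumes "stochastic P" "x \<in> S1" "y \<in> S1"
  shows "tensor_apply P x y \<in> S1"
proof -
  have "(\<Sum>i\<in>UNIV. tensor_apply P x y $ i) = (\<Sum>j\<in>UNIV. \<Sum>k\<in>UNIV. x $ j * y $ k)"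
    using sum_stochastic [OF assms(1), of "\<lambda>j k. x $ j * y $ k"]
    by (simp add: tensor_apply_def mult.assoc)
  also have "\<dots> = 1"
    using assms by (simp add: S1_iff sum_product [symmetric])
  finally show ?thesis
    using assms by (auto simp: S1_iff tensor_apply_def stochastic_def intro!: sum_nonneg)
qed

section \<open>The coefficients \<open>T_L\<close> and \<open>T_R\<close> as Lipschitz
  constants\<close>

lemma norm1_tensor_apply_le_T_L_Z1:
  assumes P: "stochastic P" and x: "x \<in> S1" and y: "y \<in> Z1"
  shows "norm1 (tensor_apply P x y) \<le> T_L P"
proof -
  \<comment> \<open>A real supremum is known to dominate its members once they are bounded above;
    the bound 1 serves the inner and the outer supremum alike.\<close>
  have le1: "norm1 (tensor_apply P u z) \<le> 1" if "u \<in> S1" "z \<in> Z1" for u z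
    using norm1_tensor_apply_le [OF P, of u z] that by (simp add: S1_def Z1_def)
  have "norm1 (tensor_apply P x y) \<le> (SUP z\<in>Z1. norm1 (tensor_apply P x z))"
    using le1 x by (intro cSUP_upper y bdd_aboveI2 [where M = 1])
  also have "\<dots> \<le> T_L P"
    unfolding T_L_def using y le1
    by (intro cSUP_upper x bdd_aboveI2 [where M = 1] cSUP_least) auto
  finally show ?thesis .
qed

text \<open>By homogeneity in the second argument, a nonzero zero-sum vector can be normalised into
  \<open>Z1\<close>.\<close>

lemma norm1_tensor_apply_le_T_L:
  assumes P: "stochastic P" and x: "x \<in> S1" and z: "(\<Sum>i\<in>UNIV. z $ i) = 0"
  shows "norm1 (tensor_apply P x z) \<le> T_L P * norm1 z"
proof (cases "z = 0")
  case True
  then show ?thesis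
    using tensor_apply_scaleR_right [of P x 0 0] by simp
next
  case False
  then have pos: "norm1 z > 0"
    using norm1_nonneg [of z] norm1_eq_0_iff [of z] by simp
  define w where "w = (1 / norm1 z) *\<^sub>R z"
  have "w \<in> Z1"
    using pos z by (simp add: w_def Z1_def norm1_scaleR sum_divide_distrib [symmetric])
  then have "norm1 (tensor_apply P x w) \<le> T_L P"
    by (rule norm1_tensor_apply_le_T_L_Z1 [OF P x])
  then show ?thesis
    using pos by (simp add: w_def tensor_apply_scaleR_right norm1_scaleR pos_divide_le_eq)
qed

text \<open>Swapping the last two indices swaps the two arguments of the bilinear map, so each fact
  about \<open>T_L\<close> yields its counterpart for \<open>T_R\<close>.\<close>

definition flip :: "'n::finite tensor3 \<Rightarrow> 'n tensor3" where
  "flip P = (\<chi> i j k. P $ i $ k $ j)"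

lemma tensor_apply_flip: "tensor_apply (flip P) x y = tensor_apply P y x"
  unfolding tensor_apply_def flip_def vec_eq_iff
  by (simp add: mult_ac) (auto intro: sum.swap)

lemma stochastic_flip: "stochastic P \<Longrightarrow> stochastic (flip P)"
  by (simp add: stochastic_def flip_def)

lemma T_L_flip: "T_L (flip P) = T_R P"
  by (simp add: T_L_def T_R_def tensor_apply_flip)

lemma T_L_nonneg:
  fixes P :: "'n::finite tensor3"
  assumes "CARD('n) \<ge> 2" "stochastic P"
  shows "0 \<le> T_L P"
proof -
  obtain y :: "real ^ 'n" where "y \<in> Z1"
    using Z1_nonempty [OF assms(1)] by blast
  then show ?thesis
    using norm1_tensor_apply_le_T_L_Z1 [OF assms(2) axis_in_S1] norm1_nonneg order_trans by blast
qed

lemma T_R_nonneg: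
  fixes P :: "'n::finite tensor3"
  assumes "CARD('n) \<ge> 2" "stochastic P"
  shows "0 \<le> T_R P"
  using T_L_nonneg [OF assms(1) stochastic_flip [OF assms(2)]] by (simp add: T_L_flip)

lemma norm1_tensor_apply_diff_le:
  assumes P: "stochastic P" and S: "u \<in> S1" "v \<in> S1" "u' \<in> S1" "v' \<in> S1"
  shows "norm1 (tensor_apply P u v - tensor_apply P u' v')
    \<le> T_L P * norm1 (v - v') + T_R P * norm1 (u - u')"
proof -
  have "norm1 (tensor_apply P u (v - v')) \<le> T_L P * norm1 (v - v')"
    using S by (intro norm1_tensor_apply_le_T_L P sum_diff_S1)
  moreover have "norm1 (tensor_apply P (u - u') v') \<le> T_R P * norm1 (u - u')"
    using norm1_tensor_apply_le_T_L [OF stochastic_flip [OF P] S(4) sum_diff_S1 [OF S(1,3)]]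
    by (simp add: tensor_apply_flip T_L_flip)
  ultimately show ?thesis
    using norm1_triangle [of "tensor_apply P u (v - v')" "tensor_apply P (u - u') v'"]
    unfolding tensor_apply_diff [of P u v u' v'] by linarith
qed

section \<open>Existence of the fixed point and convergence to it\<close>

lemma ex_fixed_point_S1:
  fixes P :: "'n::finite tensor3"
  assumes "stochastic P"
  shows "\<exists>x\<in>S1. x = tensor_apply P x x"
proof -
  have "continuous_on S1 (\<lambda>x. tensor_apply P x x)"
    unfolding tensor_apply_def by (intro continuous_intros)
  then obtain x where "x \<in> S1" "tensor_apply P x x = x"
    using brouwer [OF compact_S1 convex_S1, of "\<lambda>x. tensor_apply P x x"]
      axis_in_S1 tensor_apply_in_S1 [OF assms] by blast
  then show ?thesis by metis
qed

text \<open>The induction runs over blocks of two consecutive entries, since the maximum looks back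
  two steps: both entries of block \<open>k\<close> are at most \<open>s ^ k * M\<close>.\<close>

lemma two_step_decay:
  fixes e :: "nat \<Rightarrow> real"
  assumes s: "0 \<le> s" "s \<le> 1" and M: "0 \<le> M" and e0: "e 0 \<le> M" "e 1 \<le> M"
    and step: "\<And>t. e (t + 2) \<le> s * max (e (t + 1)) (e t)"
  shows "e t \<le> s ^ (t div 2) * M"
proof -
  have "e (2 * k) \<le> s ^ k * M \<and> e (2 * k + 1) \<le> s ^ k * M" for k
  proof (induction k)
    case 0
    then show ?case using e0 by simp
  next
    case (Suc k)
    have even: "e (2 * k + 2) \<le> s ^ Suc k * M"
      using step [of "2 * k"] mult_left_mono [of "max (e (2 * k + 1)) (e (2 * k))" "s ^ k * M" s] Suc s
      by (simp add: mult.assoc)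
    \<comment> \<open>The odd entry of the new block looks back at this even entry and at the
      previous block, so the even bound is weakened to the one they share.\<close>
    also have "\<dots> \<le> s ^ k * M"
      using s M by (intro mult_right_mono power_decreasing) auto
    finally have "e (2 * k + 3) \<le> s ^ Suc k * M"
      using step [of "2 * k + 1"] mult_left_mono [of "max (e (2 * k + 2)) (e (2 * k + 1))" "s ^ k * M" s] Suc s
      by (simp add: mult.assoc numeral_eq_Suc)
    with even show ?case by (simp add: numeral_eq_Suc)
  qed
  from this [of "t div 2"] show ?thesis
    by (cases "even t") (auto elim!: evenE oddE)
qed

theorem theorem6p3:
  fixes P :: "'n::finite tensor3" and s :: real
  assumes "CARD('n) \<ge> 2"
    and "stochastic P"
    and "s = T_L P + T_R P"
    and "s < 1"
  shows "\<exists>x\<in>S1. x = tensor_apply P x x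
    \<and> (\<forall>y\<in>S1. y = tensor_apply P y y \<longrightarrow> y = x)
    \<and> (\<forall>X :: int \<Rightarrow> real ^ 'n. X 0 \<in> S1 \<longrightarrow> X (- 1) \<in> S1 \<longrightarrow> is_iteration P X \<longrightarrow>
         (\<lambda>t::nat. X (int t)) \<longlonglongrightarrow> x
       \<and> (\<forall>t::nat. norm1 (X (int t + 1) - x)
            \<le> s ^ nat \<lceil>(real t + 1) / 2\<rceil> * max (norm1 (X 0 - x)) (norm1 (X (- 1) - x))))"
proof -
  note P = assms(2)
  have L: "0 \<le> T_L P" and R: "0 \<le> T_R P"
    using T_L_nonneg T_R_nonneg assms by blast+
  then have s0: "0 \<le> s" using assms(3) by simp
  obtain x where x: "x \<in> S1" and fix_x: "x = tensor_apply P x x"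
    using ex_fixed_point_S1 [OF P] by blast
  have unique: "y = x" if y: "y \<in> S1" and fix_y: "y = tensor_apply P y y" for y
  proof -
    have "norm1 (y - x) \<le> s * norm1 (y - x)"
      using norm1_tensor_apply_diff_le [OF P y y x x]
      by (simp add: assms(3) distrib_right fix_x [symmetric] fix_y [symmetric])
    then have "(1 - s) * norm1 (y - x) \<le> 0"
      by (simp add: algebra_simps)
    then have "norm1 (y - x) = 0"
      using norm1_nonneg [of "y - x"] assms(4) by (simp add: mult_le_0_iff)
    then show ?thesis by (simp add: norm1_eq_0_iff)
  qed
  have conv: "(\<lambda>t::nat. X (int t)) \<longlonglongrightarrow> x
       \<and> (\<forall>t::nat. norm1 (X (int t + 1) - x)
            \<le> s ^ nat \<lceil>(real t + 1) / 2\<rceil> * max (norm1 (X 0 - x)) (norm1 (X (- 1) - x)))"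
    if X0: "X 0 \<in> S1" and X1: "X (- 1) \<in> S1" and it: "is_iteration P X" for X
  proof -
    define M where "M = max (norm1 (X 0 - x)) (norm1 (X (- 1) - x))"
    \<comment> \<open>The index is shifted by one: \<open>e 0\<close> is the error of
      \<open>X (- 1)\<close> and \<open>e 1\<close> that of \<open>X 0\<close>.\<close>
    define e where "e t = norm1 (X (int t - 1) - x)" for t
    have XS: "X (int t) \<in> S1 \<and> X (int t - 1) \<in> S1" for t
    proof (induction t)
      case 0
      then show ?case using X0 X1 by simp
    next
      case (Suc t)
      have "X (int t + 1) = tensor_apply P (X (int t)) (X (int t - 1))"
        using it by (simp add: is_iteration_def)
      then show ?case
        using Suc tensor_apply_in_S1 [OF P] by (simp add: add.commute)
    qed
    have step: "e (t + 2) \<le> s * max (e (t + 1)) (e t)" for t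
    proof -
      have "X (int t + 1) = tensor_apply P (X (int t)) (X (int t - 1))"
        using it by (simp add: is_iteration_def)
      \<comment> \<open>\<open>T_L\<close> weighs the second argument, hence the older error
        \<open>e t\<close>.\<close>
      then have "e (t + 2) \<le> T_L P * e t + T_R P * e (t + 1)"
        using norm1_tensor_apply_diff_le [OF P _ _ x x, of "X (int t)" "X (int t - 1)"] XS [of t]
        by (simp add: e_def fix_x [symmetric] add.commute)
      also have "\<dots> \<le> T_L P * max (e (t + 1)) (e t) + T_R P * max (e (t + 1)) (e t)"
        using L R by (intro add_mono mult_left_mono) auto
      finally show ?thesis by (simp add: assms(3) distrib_right)
    qed
    have decay: "e t \<le> s ^ (t div 2) * M" for t
      using assms(4) by (intro two_step_decay s0 step) (auto simp: M_def e_def norm1_nonneg le_max_iff_disj)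
    have "norm1 (X (int t + 1) - x) \<le> s ^ nat \<lceil>(real t + 1) / 2\<rceil> * M" for t
    proof -
      \<comment> \<open>The error of \<open>X (int t + 1)\<close> is \<open>e (t + 2)\<close>, and
        halving \<open>t + 2\<close> rounded down is halving \<open>t + 1\<close> rounded
        up.\<close>
      have "nat \<lceil>(real t + 1) / 2\<rceil> = (t + 2) div 2"
        by (cases "even t") (auto elim!: evenE oddE simp: ceiling_eq_iff nat_eq_iff)
      then show ?thesis using decay [of "t + 2"] by (simp add: e_def add.commute)
    qed
    moreover have "(\<lambda>t::nat. X (int t)) \<longlonglongrightarrow> x"
    proof -
      \<comment> \<open>Convergence refers to the Euclidean norm, which the 1-norm
        dominates.\<close>
      have "norm (X (int t) - x) \<le> s ^ (Suc t div 2) * M" for t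
        using norm_le_norm1 [of "X (int t) - x"] decay [of "Suc t"] by (simp add: e_def)
      moreover have "(\<lambda>t. s ^ (Suc t div 2) * M) \<longlonglongrightarrow> 0"
      proof -
        have "filterlim (\<lambda>t. Suc t div 2) sequentially sequentially"
          by (rule filterlim_compose [OF filterlim_at_top_div_const_nat filterlim_Suc]) simp
        then have "(\<lambda>t. s ^ (Suc t div 2)) \<longlonglongrightarrow> 0"
          using LIMSEQ_power_zero [of s] s0 assms(4) by (auto intro: filterlim_compose)
        then show ?thesis by (rule tendsto_mult_left_zero)
      qed
      ultimately have "(\<lambda>t. X (int t) - x) \<longlonglongrightarrow> 0"
        by (rule Lim_null_comparison [OF always_eventually [OF allI]])
      then show ?thesis by (rule LIM_zero_cancel)
    qed
    ultimately show ?thesis by (simp add: M_def)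
  qed
  show ?thesis
    using x fix_x unique conv by (intro bexI [of _ x]) blast+
qed

end
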